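(* Let $f\in\mathcal{NP}_+$, $q>2$, $\lambda\in\Sigma_{\pi/q}$ and $z\in\Sigma_{\pi-\pi/q}$. 1. Assume that $f(\infty)$ exists. Then $$(z+f(\lambda))^{-1}=\frac1{z+f(\infty)}+\frac q\pi\int_0^\infty\frac{\operatorname{Im}f(te^{i\pi/q})\,t^{q-1}}{(z+f(te^{i\pi/q}))(z+f(te^{-i\pi/q}))(\lambda^q+t^q)}\,dt,$$ where the integral may be improper. 2. Assume that $f(0+)$ exists. Then $$(z+f(\lambda))^{-1}=\frac1{z+f(0+)}-\frac q\pi\int_0^\infty\frac{\operatorname{Im}f(te^{i\pi/q})\,\lambda^q}{(z+f(te^{i\pi/q}))(z+f(te^{-i\pi/q}))(\lambda^q+t^q)\,t}\,dt,$$ where the integral may be improper.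
   Context: $\mathbb{C}_+=\{\lambda\in\mathbb{C}:\operatorname{Re}\lambda>0\}$; $\Sigma_\theta=\{z\in\mathbb{C}: z\ne0,\ |\arg z|<\theta\}$ for $\theta\in(0,\pi]$. Powers are principal branches. $\mathcal{NP}_+$ is the set of holomorphic $f:\mathbb{C}_+\to\mathbb{C}_+$ with $f((0,\infty))\subset(0,\infty)$. $f(0+)=\lim_{t\to0+}f(t)$ and $f(\infty)=\lim_{t\to\infty}f(t)$ (real $t$), when these limits exist in $[0,\infty]$; $\frac{1}{z+\infty}:=0$. *)

theory Defs
  imports "HOL-Complex_Analysis.Complex_Analysis"
begin

definition right_halfplane :: "complex set" where
  "right_halfplane = {w. Re w > 0}"

definition sector :: "real \<Rightarrow> complex set" where
  "sector \<theta> = {w. w \<noteq> 0 \<and> \<bar>Arg w\<bar> < \<theta>}"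

definition NP_plus :: "(complex \<Rightarrow> complex) set" where
  "NP_plus = {f. f holomorphic_on right_halfplane \<and>
     f ` right_halfplane \<subseteq> right_halfplane \<and>
     (\<forall>t::real. t > 0 \<longrightarrow> (\<exists>s::real. s > 0 \<and> f (of_real t) = of_real s))}"

(* For f in NP_plus the values on the positive half-line are positive reals, so taking
   Re and embedding into ennreal loses nothing; the limit may be 0 or \<infinity>. *)
definition has_limit_at_zero :: "(complex \<Rightarrow> complex) \<Rightarrow> ennreal \<Rightarrow> bool" where
  "has_limit_at_zero f L \<longleftrightarrow>
     ((\<lambda>t::real. ennreal (Re (f (of_real t)))) \<longlongrightarrow> L) (at_right 0)"

definition has_limit_at_infinity :: "(complex \<Rightarrow> complex) \<Rightarrow> ennreal \<Rightarrow> bool" where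
  "has_limit_at_infinity f L \<longleftrightarrow>
     ((\<lambda>t::real. ennreal (Re (f (of_real t)))) \<longlongrightarrow> L) at_top"

(* 1 / (z + L), with the convention 1 / (z + \<infinity>) = 0 *)
definition recip_add :: "complex \<Rightarrow> ennreal \<Rightarrow> complex" where
  "recip_add z L = (if L = \<infinity> then 0 else 1 / (z + of_real (enn2real L)))"

(* The integral of F over (0,\<infinity>) converges to I, possibly only conditionally: the two
   endpoints tend to 0 and \<infinity> independently of each other. *)
definition has_improper_integral :: "(real \<Rightarrow> complex) \<Rightarrow> complex \<Rightarrow> bool" where
  "has_improper_integral F I \<longleftrightarrow>
     (\<forall>a b. 0 < a \<longrightarrow> a \<le> b \<longrightarrow> F integrable_on {a..b}) \<and>
     ((\<lambda>(a, b). integral {a..b} F) \<longlongrightarrow> I) (at_right 0 \<times>\<^sub>F at_top)"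

end

theory Submission
  imports Defs
begin

text \<open>
  By the Schwarz-Pick inequality, compared with a point of the positive half-line (which is preserved),
  \<open>f\<close> does not increase \<open>|arg|\<close>. Hence \<open>w \<mapsto> 1 / (z + f w)\<close> is bounded and holomorphic on a
  sector slightly wider than the closed sector of half-angle \<open>pi / q\<close>. The substitution
  \<open>s = q log w\<close> turns this sector into a strip of half-width \<open>\<Theta> > pi\<close>, and \<open>w powr q\<close> into
  \<open>exp s\<close>. With \<open>m = \<mu> powr q\<close>, integrate the transplanted function \<open>F\<close> against
  \<open>exp s / (exp s - m)\<close> (part 1) or \<open>m / (exp s - m)\<close> (part 2) around a rectangle of height
  \<open>2 pi\<close>: the only pole inside is \<open>q log \<mu>\<close>, the horizontal sides give the integral over
  \<open>(0,\<infinity>)\<close> since \<open>exp s\<close> is real and negative there, and each vertical side converges separately.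
  One of them vanishes because \<open>F\<close> is bounded and the kernel decays; on the other one \<open>F\<close> tends
  uniformly to its radial limit, by Montel's theorem applied to the horizontal translates of \<open>F\<close>.
\<close>

section \<open>The class of positive functions and arguments\<close>

lemma NP_plus_holomorphic: "f \<in> NP_plus \<Longrightarrow> f holomorphic_on {w. Re w > 0}"
  by (simp add: NP_plus_def right_halfplane_def)

lemma NP_plus_Re_pos: "f \<in> NP_plus \<Longrightarrow> Re w > 0 \<Longrightarrow> Re (f w) > 0"
  by (auto simp: NP_plus_def right_halfplane_def)

lemma NP_plus_of_real: "f \<in> NP_plus \<Longrightarrow> t > 0 \<Longrightarrow> f (of_real t) = of_real (Re (f (of_real t)))"
  unfolding NP_plus_def by fastforce

text \<open>The half-plane consists of the points closer to \<open>s\<close> than to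
  \<open>- s\<close>. So the Cayley quotient \<open>(v - s) / (v + s)\<close> has modulus below 1,
  both for the argument and for the value of \<open>f\<close>.\<close>

lemma cmod_minus_less_cmod_plus:
  assumes "Re v > 0" "s > 0"
  shows "cmod (v - of_real s) < cmod (v + of_real s)"
proof -
  have "(cmod (v - of_real s))\<^sup>2 < (cmod (v + of_real s))\<^sup>2"
    using mult_pos_pos[OF assms] unfolding cmod_power2
    by (simp add: power2_eq_square algebra_simps)
  then show ?thesis
    using power_less_imp_less_base norm_ge_zero by blast
qed

text \<open>Cayley transforms centred at \<open>t\<close> and at \<open>f t\<close> turn
  \<open>f\<close> into a self-map of the disc fixing 0, to which the Schwarz lemma applies. As
  \<open>f t\<close> is a positive real, the two transforms have the same form. The denominators are
  then cleared.\<close>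

lemma NP_plus_Schwarz_Pick:
  assumes f: "f \<in> NP_plus" and w: "Re w > 0" and t: "t > 0"
  shows "cmod (f w - f t) * cmod (w + of_real t) \<le> cmod (w - of_real t) * cmod (f w + f t)"
proof -
  define s where "s = Re (f (of_real t))"
  have s: "s > 0" "f (of_real t) = of_real s"
    using NP_plus_Re_pos[OF f, of "of_real t"] NP_plus_of_real[OF f t] t by (auto simp: s_def)
  \<comment> \<open>\<open>\<phi>\<close> is the inverse Cayley transform, mapping the disc to the
    half-plane and 0 to \<open>t\<close>; \<open>h\<close> below is \<open>f\<close> read in disc
    coordinates on both sides.\<close>
  define \<phi> where "\<phi> = (\<lambda>u::complex. of_real t * (1 + u) / (1 - u))"
  define h where "h = (\<lambda>u. (f (\<phi> u) - of_real s) / (f (\<phi> u) + of_real s))"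
  have \<phi>_pos: "Re (\<phi> u) > 0" if "norm u < 1" for u
  proof -
    have "(Re u)\<^sup>2 + (Im u)\<^sup>2 < 1"
      using that by (simp add: cmod_def)
    moreover have "(1 - Re u)\<^sup>2 + (Im u)\<^sup>2 > 0"
      using that by (metis complex_eq_iff complex_neq_0 less_irrefl minus_complex.simps one_complex.simps
          norm_one diff_0 power2_minus right_minus_eq)
    moreover have "Re (\<phi> u) = t * (1 - ((Re u)\<^sup>2 + (Im u)\<^sup>2)) / ((1 - Re u)\<^sup>2 + (Im u)\<^sup>2)"
      unfolding \<phi>_def by (simp add: Re_divide algebra_simps power2_eq_square)
    ultimately show ?thesis
      using t by simp
  qed
  have ne1: "1 - u \<noteq> 0" if "norm u < 1" for u :: complex
    using that by auto
  have \<phi>_hol: "\<phi> holomorphic_on ball 0 1"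
    unfolding \<phi>_def using ne1 by (intro holomorphic_intros) auto
  have f\<phi>_hol: "(\<lambda>u. f (\<phi> u)) holomorphic_on ball 0 1"
    by (rule holomorphic_on_compose_gen[OF \<phi>_hol NP_plus_holomorphic[OF f], unfolded o_def])
      (use \<phi>_pos in auto)
  have ne2: "v + of_real s \<noteq> 0" if "Re v > 0" for v
    using that s by (auto simp: complex_eq_iff)
  have "norm (h u) \<le> norm u" if "norm u < 1" for u
  proof (rule Schwarz_Lemma(1))
    show "h holomorphic_on ball 0 1"
      unfolding h_def using \<phi>_pos NP_plus_Re_pos[OF f] ne2
      by (intro holomorphic_intros f\<phi>_hol) auto
    show "h 0 = 0" by (simp add: h_def \<phi>_def s)
    show "norm (h u) < 1" if "norm u < 1" for u
    proof -
      have "Re (f (\<phi> u)) > 0" using NP_plus_Re_pos[OF f \<phi>_pos[OF that]] .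
      then show ?thesis
        unfolding h_def norm_divide using cmod_minus_less_cmod_plus[OF _ s(1)] ne2
        by (subst divide_less_eq_1_pos) auto
    qed
  qed (use that in auto)
  moreover define u where "u = (w - of_real t) / (w + of_real t)"
  have nw: "w + of_real t \<noteq> 0" using w t by (auto simp: complex_eq_iff)
  then have u1: "norm u < 1"
    unfolding u_def norm_divide using cmod_minus_less_cmod_plus[OF w t]
    by (subst divide_less_eq_1_pos) auto
  moreover have "\<phi> u = w"
  proof -
    have "1 + u = 2 * w / (w + of_real t)" "1 - u = 2 * of_real t / (w + of_real t)"
      using nw by (simp_all add: u_def field_simps)
    then show ?thesis using nw t by (simp add: \<phi>_def)
  qed
  ultimately have "cmod ((f w - of_real s) / (f w + of_real s)) \<le> cmod ((w - of_real t) / (w + of_real t))"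
    by (metis h_def u_def)
  then have "cmod (f w - of_real s) / cmod (f w + of_real s) \<le> cmod (w - of_real t) / cmod (w + of_real t)"
    by (simp only: norm_divide)
  moreover have "cmod (f w + of_real s) > 0" "cmod (w + of_real t) > 0"
    using nw ne2[OF NP_plus_Re_pos[OF f w]] by simp_all
  ultimately show ?thesis
    by (simp only: s frac_le_eq pos_divide_le_eq pos_le_divide_eq) (simp add: field_simps)
qed

text \<open>Choosing \<open>t = |w|\<close> in the Schwarz-Pick inequality gives the best bound on the argument.\<close>

lemma NP_plus_Re_ge:
  assumes f: "f \<in> NP_plus" and w: "Re w > 0"
  shows "Re w * cmod (f w) \<le> cmod w * Re (f w)"
proof -
  define r where "r = cmod w"
  have r: "r > 0" using w by (auto simp: r_def)
  define s where "s = Re (f (of_real r))"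
  have s: "s > 0" "f (of_real r) = of_real s"
    using NP_plus_Re_pos[OF f, of "of_real r"] NP_plus_of_real[OF f r] r by (auto simp: s_def)
  define v where "v = f w"
  have v: "Re v > 0" using NP_plus_Re_pos[OF f w] by (simp add: v_def)
  have eq: "(cmod (x + of_real a))\<^sup>2 = (cmod x)\<^sup>2 + a\<^sup>2 + 2 * a * Re x"
       "(cmod (x - of_real a))\<^sup>2 = (cmod x)\<^sup>2 + a\<^sup>2 - 2 * a * Re x" for x a
    unfolding cmod_power2 by (simp_all add: power2_eq_square algebra_simps)
  have "(cmod (v - of_real s) * cmod (w + of_real r))\<^sup>2 \<le> (cmod (w - of_real r) * cmod (v + of_real s))\<^sup>2"
    using NP_plus_Schwarz_Pick[OF f w r] by (intro power_mono) (auto simp: s v_def)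
  then have "((cmod v)\<^sup>2 + s\<^sup>2 - 2 * s * Re v) * (r\<^sup>2 + r\<^sup>2 + 2 * r * Re w)
      \<le> (r\<^sup>2 + r\<^sup>2 - 2 * r * Re w) * ((cmod v)\<^sup>2 + s\<^sup>2 + 2 * s * Re v)"
    by (simp add: power_mult_distrib eq r_def)
  \<comment> \<open>Since \<open>r = cmod w\<close>, the products of two terms with a real part, as
    well as those with none, are equal on both sides and cancel; only the mixed terms
    survive.\<close>
  then have "4 * r * (Re w * ((cmod v)\<^sup>2 + s\<^sup>2)) \<le> 4 * r * (r * (2 * s * Re v))"
    by (simp add: algebra_simps power2_eq_square)
  then have 1: "Re w * ((cmod v)\<^sup>2 + s\<^sup>2) \<le> r * (2 * s * Re v)"
    using r by simp
  \<comment> \<open>The inequality between arithmetic and geometric means makes both sides multiples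
    of the unknown value \<open>s = f r\<close>, which then divides out.\<close>
  have "2 * s * cmod v \<le> (cmod v)\<^sup>2 + s\<^sup>2"
    using sum_squares_bound[of s "cmod v"] by (simp add: add.commute)
  then have "Re w * (2 * s * cmod v) \<le> Re w * ((cmod v)\<^sup>2 + s\<^sup>2)"
    using w by (intro mult_left_mono) auto
  with 1 have "2 * s * (Re w * cmod v) \<le> 2 * s * (r * Re v)"
    by (simp add: algebra_simps)
  then show ?thesis using s by (simp add: v_def r_def)
qed

text \<open>The preceding inequality compares the cosines of the two arguments, and cosine decreases
  on \<open>[0, pi]\<close>.\<close>

lemma NP_plus_Arg_le:
  assumes f: "f \<in> NP_plus" and w: "Re w > 0"
  shows "\<bar>Arg (f w)\<bar> \<le> \<bar>Arg w\<bar>"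
proof -
  have v: "Re (f w) > 0" using NP_plus_Re_pos[OF f w] .
  have ne: "w \<noteq> 0" "f w \<noteq> 0" using w v by auto
  have "cos \<bar>Arg w\<bar> \<le> cos \<bar>Arg (f w)\<bar>"
    using NP_plus_Re_ge[OF f w] ne by (simp add: cos_Arg divide_simps mult.commute)
  moreover have "\<bar>Arg w\<bar> \<le> pi" "\<bar>Arg (f w)\<bar> \<le> pi"
    using mpi_less_Arg[of w] Arg_le_pi[of w] mpi_less_Arg[of "f w"] Arg_le_pi[of "f w"] by auto
  ultimately show ?thesis
    using cos_mono_le_eq[of "\<bar>Arg w\<bar>" "\<bar>Arg (f w)\<bar>"] by linarith
qed

lemma islimpt_of_real_image:
  assumes "x islimpt A"
  shows "of_real x islimpt (of_real ` A :: complex set)"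
  unfolding islimpt_approachable
proof (intro allI impI)
  fix e :: real assume "e > 0"
  then obtain y where "y \<in> A" "y \<noteq> x" "dist y x < e"
    using assms islimpt_approachable by metis
  then show "\<exists>w\<in>of_real ` A. w \<noteq> complex_of_real x \<and> dist w (of_real x) < e"
    by (intro bexI[of _ "of_real y"]) (auto simp: dist_of_real)
qed

text \<open>Schwarz reflection: \<open>f\<close> and \<open>cnj \<circ> f \<circ> cnj\<close> agree
  on the positive half-line, hence everywhere by the identity theorem. This later turns the jump
  between the two rays into an imaginary part.\<close>

lemma NP_plus_cnj:
  assumes f: "f \<in> NP_plus" and w: "Re w > 0"
  shows "f (cnj w) = cnj (f w)"
proof -
  define S where "S = {w. Re w > 0}"
  have S: "open S" "connected S"
    unfolding S_def by (auto intro: open_halfspace_Re_gt convex_connected convex_halfspace_Re_gt)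
  have hol: "(\<lambda>w. f w - (cnj \<circ> f \<circ> cnj) w) holomorphic_on S"
    using NP_plus_holomorphic[OF f] S
    by (intro holomorphic_intros holomorphic_on_compose_cnj_cnj)
      (auto simp: S_def image_iff intro!: holomorphic_on_subset[OF NP_plus_holomorphic[OF f]])
  have lim: "1 islimpt complex_of_real ` {0<..}"
    using islimpt_of_real_image[OF interior_limit_point[of 1 "{0<..}"]] by (simp add: interior_open)
  have zero: "f u - (cnj \<circ> f \<circ> cnj) u = 0" if u: "u \<in> complex_of_real ` {0<..}" for u
  proof -
    obtain t where t: "t > 0" "u = of_real t" using u by auto
    obtain s where "f u = complex_of_real s" using NP_plus_of_real[OF f t(1)] t(2) by blast
    then show ?thesis using t(2) by simp
  qed
  have sub: "complex_of_real ` {0<..} \<subseteq> S" "1 \<in> S" "w \<in> S" using w by (auto simp: S_def)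
  have "f w - (cnj \<circ> f \<circ> cnj) w = 0"
    by (rule analytic_continuation[OF hol S sub(1,2) lim zero sub(3)])
  then have "f w = cnj (f (cnj w))" by simp
  then show ?thesis by (metis complex_cnj_cnj)
qed

text \<open>The angle between \<open>z\<close> and \<open>v\<close> is at most
  \<open>\<gamma>\<close>, so the law of cosines, with the square completed in
  \<open>cmod v\<close>, bounds the sum from below. The bound does not depend on the size of
  \<open>v\<close>, which makes the resolvent uniformly bounded.\<close>

lemma cmod_add_ge:
  assumes "\<bar>Arg z\<bar> + \<bar>Arg v\<bar> \<le> \<gamma>" "\<gamma> \<le> pi"
  shows "cmod z * sin \<gamma> \<le> cmod (z + v)"
proof -
  define a b where "a = cmod z" and "b = cmod v"
  have ab: "a \<ge> 0" "b \<ge> 0" by (auto simp: a_def b_def)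
  have z: "Re z = a * cos (Arg z)" "Im z = a * sin (Arg z)"
    by (metis Re_rcis a_def rcis_cmod_Arg, metis Im_rcis a_def rcis_cmod_Arg)
  have v: "Re v = b * cos (Arg v)" "Im v = b * sin (Arg v)"
    by (metis Re_rcis b_def rcis_cmod_Arg, metis Im_rcis b_def rcis_cmod_Arg)
  have "cos \<gamma> \<le> cos \<bar>Arg z - Arg v\<bar>"
    using assms by (intro cos_monotone_0_pi_le) auto
  then have "a * b * cos \<gamma> \<le> a * b * cos (Arg z - Arg v)"
    using ab by (auto intro: mult_left_mono)
  also have "\<dots> = Re z * Re v + Im z * Im v"
    by (simp add: z v cos_diff algebra_simps)
  finally have 1: "a * b * cos \<gamma> \<le> Re z * Re v + Im z * Im v" .
  have "(a * sin \<gamma>)\<^sup>2 \<le> (b + a * cos \<gamma>)\<^sup>2 + (a * sin \<gamma>)\<^sup>2" by simp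
  also have "\<dots> = b\<^sup>2 + a\<^sup>2 * ((sin \<gamma>)\<^sup>2 + (cos \<gamma>)\<^sup>2) + 2 * (a * b * cos \<gamma>)"
    by (simp only: power2_eq_square) algebra
  also have "\<dots> \<le> b\<^sup>2 + a\<^sup>2 + 2 * (Re z * Re v + Im z * Im v)"
    using 1 by simp
  also have "\<dots> = (cmod (z + v))\<^sup>2"
    unfolding a_def b_def cmod_power2 by (simp add: power2_eq_square algebra_simps)
  finally show ?thesis
    unfolding a_def by (rule power2_le_imp_le) simp
qed

section \<open>Contour integration in a strip\<close>

definition strip :: "real \<Rightarrow> complex set" where
  "strip \<Theta> = {s. \<bar>Im s\<bar> < \<Theta>}"

lemma open_strip: "open (strip \<Theta>)"
  unfolding strip_def by (intro open_Collect_less continuous_intros)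

lemma connected_strip: "connected (strip \<Theta>)"
proof -
  have "strip \<Theta> = {s. Im s < \<Theta>} \<inter> {s. Im s > - \<Theta>}"
    by (auto simp: strip_def)
  then show ?thesis
    by (auto intro!: convex_connected convex_Int convex_halfspace_Im_lt convex_halfspace_Im_gt)
qed

text \<open>The imaginary parts differ by a multiple of \<open>2 * pi\<close> that is smaller than
  \<open>2 * pi\<close> in modulus. Bounding the sum of the two heights allows one point to lie
  beyond height \<open>pi\<close> if the other lies low enough.\<close>

lemma exp_eq_in_strip:
  assumes "exp s = exp l" "\<bar>Im s\<bar> + \<bar>Im l\<bar> < 2 * pi"
  shows "s = l"
proof -
  obtain n :: int where n: "s = l + (of_int (2 * n) * pi) * \<i>"
    using assms(1) by (auto simp: exp_eq)
  have "Im s = Im l + 2 * of_int n * pi" by (simp add: n)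
  then have "\<bar>2 * of_int n * pi\<bar> < 2 * pi"
    using assms(2) by linarith
  then have "\<bar>real_of_int n\<bar> < 1" by (simp add: abs_mult)
  then have "n = 0" by linarith
  with n show ?thesis by simp
qed

lemma contour_integral_linepath_same_Im:
  assumes "a < b"
  shows "contour_integral (linepath (Complex a c) (Complex b c)) f = integral {a..b} (\<lambda>x. f (Complex x c))"
proof -
  have "contour_integral (linepath (Complex a c) (Complex b c)) f
      = contour_integral (linepath (of_real a) (of_real b)) (\<lambda>w. f (w + \<i> * of_real c))"
    by (simp add: contour_integral_integral linepath_def Complex_eq scaleR_conv_of_real algebra_simps)
  also have "\<dots> = integral {a..b} (\<lambda>x. f (Complex x c))"
    using assms by (subst contour_integral_linepath_Reals_eq) (auto simp: Complex_eq)
  finally show ?thesis .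
qed

text \<open>The horizontal sides are merged into one integrand because only their difference becomes
  the integrand over \<open>(0,\<infinity>)\<close>; the vertical sides stay apart because each has
  its own limit.\<close>

lemma contour_integral_rectpath:
  assumes "a < b" "c < d" and cont: "continuous_on (path_image (rectpath (Complex a c) (Complex b d))) f"
  shows "contour_integral (rectpath (Complex a c) (Complex b d)) f =
    integral {a..b} (\<lambda>x. f (Complex x c) - f (Complex x d)) +
    \<i> * (integral {c..d} (\<lambda>y. f (Complex b y)) - integral {c..d} (\<lambda>y. f (Complex a y)))"
proof -
  let ?P = "path_image (rectpath (Complex a c) (Complex b d))"
  have P: "?P = {z. Re z \<in> {a, b} \<and> Im z \<in> {c..d}} \<union> {z. Im z \<in> {c, d} \<and> Re z \<in> {a..b}}"
    using assms by (subst path_image_rectpath) auto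
  have seg: "closed_segment (Complex a c) (Complex b c) \<subseteq> ?P"
    "closed_segment (Complex b c) (Complex b d) \<subseteq> ?P"
    "closed_segment (Complex b d) (Complex a d) \<subseteq> ?P"
    "closed_segment (Complex a d) (Complex a c) \<subseteq> ?P"
    using assms(1,2) unfolding P
    by (auto simp: closed_segment_same_Re closed_segment_same_Im closed_segment_eq_real_ivl)
  note ci = contour_integrable_continuous_linepath[OF continuous_on_subset[OF cont]]
  have int: "(\<lambda>x. f (Complex x t)) integrable_on {a..b}" if "t \<in> {c, d}" for t
    using that unfolding Complex_eq
    by (intro integrable_continuous_real continuous_on_compose2[OF cont] continuous_intros)
      (auto simp: P)
  have "contour_integral (rectpath (Complex a c) (Complex b d)) f =
      contour_integral (linepath (Complex a c) (Complex b c)) f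
      + contour_integral (linepath (Complex b c) (Complex b d)) f
      + contour_integral (linepath (Complex b d) (Complex a d)) f
      + contour_integral (linepath (Complex a d) (Complex a c)) f"
    unfolding rectpath_def Let_def using seg ci
    by (simp add: contour_integrable_join valid_path_join)
  also have "contour_integral (linepath (Complex b d) (Complex a d)) f
      = - contour_integral (linepath (Complex a d) (Complex b d)) f"
    by (rule contour_integral_reverse_linepath) (use continuous_on_subset[OF cont seg(3)] in simp)
  also have "contour_integral (linepath (Complex a d) (Complex a c)) f
      = - contour_integral (linepath (Complex a c) (Complex a d)) f"
    by (rule contour_integral_reverse_linepath) (use continuous_on_subset[OF cont seg(4)] in simp)
  finally show ?thesis
    using assms(1,2) int
    by (simp add: contour_integral_linepath_same_Im contour_integral_linepath_same_Re[of _ a _ c d]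
      contour_integral_linepath_same_Re[of _ b _ c d] integral_diff algebra_simps)
qed

text \<open>By \<open>exp_eq_in_strip\<close> the denominator vanishes only at \<open>l\<close>. Its
  derivative there is \<open>exp l\<close>, which the normalisation \<open>H l = exp l\<close>
  cancels, so the residue is \<open>F l\<close> for either choice of kernel.\<close>

lemma strip_residue:
  assumes F: "F holomorphic_on strip \<Theta>" and H: "H holomorphic_on strip \<Theta>"
    and \<Theta>: "pi < \<Theta>" "\<Theta> + \<bar>Im l\<bar> \<le> 2 * pi"
    and l: "x0 < Re l" "Re l < x1" "H l = exp l"
  defines "K \<equiv> \<lambda>s. F s * H s / (exp s - exp l)"
  shows "integral {x0..x1} (\<lambda>x. K (Complex x (-pi)) - K (Complex x pi)) +
    \<i> * (integral {-pi..pi} (\<lambda>y. K (Complex x1 y)) - integral {-pi..pi} (\<lambda>y. K (Complex x0 y))) =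
    2 * pi * \<i> * F l"
proof -
  let ?R = "rectpath (Complex x0 (-pi)) (Complex x1 pi)"
  have Iml: "\<bar>Im l\<bar> < pi" using \<Theta> by linarith
  then have lS: "l \<in> strip \<Theta>" using \<Theta> by (auto simp: strip_def)
  have ne: "exp s - exp l \<noteq> 0" if "s \<in> strip \<Theta> - {l}" for s
    using exp_eq_in_strip[of s l] that \<Theta> by (auto simp: strip_def)
  have K: "K holomorphic_on strip \<Theta> - {l}"
    unfolding K_def using ne
    by (intro holomorphic_intros holomorphic_on_subset[OF F] holomorphic_on_subset[OF H]) auto
  have P: "path_image ?R = {z. Re z \<in> {x0, x1} \<and> Im z \<in> {-pi..pi}} \<union>
      {z. Im z \<in> {-pi, pi} \<and> Re z \<in> {x0..x1}}"
    using l by (subst path_image_rectpath) auto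
  then have R: "path_image ?R \<subseteq> strip \<Theta> - {l}"
    using \<Theta> l Iml by (auto simp: strip_def)
  have "((\<lambda>s. (exp s - exp l) / (s - l)) \<longlongrightarrow> exp l) (at l)"
    using DERIV_exp[of l] by (simp add: has_field_derivative_iff)
  moreover have "isCont F l" "isCont H l"
    using F H lS open_strip by (auto simp: continuous_on_eq_continuous_at dest!: holomorphic_on_imp_continuous_on)
  then have "(F \<longlongrightarrow> F l) (at l)" "(H \<longlongrightarrow> H l) (at l)"
    by (auto dest: isContD)
  ultimately have "((\<lambda>s. F s * H s / ((exp s - exp l) / (s - l))) \<longlongrightarrow> F l * H l / exp l) (at l)"
    by (intro tendsto_intros) auto
  then have "residue K l = F l"
    by (intro residue_simple'[OF open_strip lS K]) (simp add: K_def l)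
  moreover have "winding_number ?R l = 1"
    using l Iml by (intro winding_number_rectpath) (auto simp: in_box_complex_iff)
  moreover have "contour_integral ?R K = 2 * pi * \<i> * (\<Sum>p\<in>{l}. winding_number ?R p * residue K p)"
  proof (rule Residue_theorem[OF open_strip connected_strip _ K])
    show "\<forall>z. z \<notin> strip \<Theta> \<longrightarrow> winding_number ?R z = 0"
    proof (intro allI impI winding_number_zero_outside[of _ "cbox (Complex x0 (-pi)) (Complex x1 pi)"])
      fix z assume "z \<notin> strip \<Theta>"
      then show "z \<notin> cbox (Complex x0 (-pi)) (Complex x1 pi)"
        using \<Theta> by (auto simp: strip_def in_cbox_complex_iff)
    qed (use l path_image_rectpath_subset_cbox in auto)
  qed (use R in auto)
  moreover have "continuous_on (path_image ?R) K"
    using K R holomorphic_on_imp_continuous_on continuous_on_subset by blast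
  ultimately show ?thesis
    using contour_integral_rectpath[of x0 x1 "-pi" pi K] l by simp
qed

section \<open>Limits of the vertical sides\<close>

text \<open>The translates of \<open>F\<close> share the bound \<open>B\<close> and form a normal
  family. The hypothesis for every real shift \<open>t\<close> identifies any subsequential limit
  with \<open>c\<close> on the real axis, hence on the whole strip.\<close>

lemma strip_uniform_limit:
  assumes F: "F holomorphic_on strip \<Theta>" and B: "\<And>s. s \<in> strip \<Theta> \<Longrightarrow> norm (F s) \<le> B"
    and lim: "\<And>t. (\<lambda>n. F (of_real (X n + t))) \<longlonglongrightarrow> c"
    and K: "compact K" "K \<subseteq> strip \<Theta>" and "0 < \<Theta>"
  shows "uniform_limit K (\<lambda>n s. F (of_real (X n) + s)) (\<lambda>_. c) sequentially"
proof (rule ccontr)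
  assume "\<not> ?thesis"
  then obtain e where e: "e > 0" "\<not> (\<forall>\<^sub>F n in sequentially. \<forall>s\<in>K. dist (F (of_real (X n) + s)) c < e)"
    by (auto simp: uniform_limit_iff)
  \<comment> \<open>A subsequence along which the distance to \<open>c\<close> reaches
    \<open>e\<close> somewhere on \<open>K\<close>. Montel's theorem extracts a locally uniformly
    convergent subsequence of it, which yields the contradiction.\<close>
  then obtain p :: "nat \<Rightarrow> nat" where p: "strict_mono p"
    "\<And>n. \<not> (\<forall>s\<in>K. dist (F (of_real (X (p n)) + s)) c < e)"
    using not_eventually_sequentiallyD[OF e(2)] by auto
  define G where "G = (\<lambda>n s. F (of_real (X (p n)) + s))"
  have in_strip: "of_real x + s \<in> strip \<Theta> \<longleftrightarrow> s \<in> strip \<Theta>" for x s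
    by (simp add: strip_def)
  have G: "G n holomorphic_on strip \<Theta>" for n
    unfolding G_def
    by (rule holomorphic_on_compose_gen[OF _ F, unfolded o_def]) (auto intro!: holomorphic_intros simp: in_strip)
  obtain h r where hr: "h holomorphic_on strip \<Theta>" "strict_mono (r :: nat \<Rightarrow> nat)"
    "\<And>s. s \<in> strip \<Theta> \<Longrightarrow> (\<lambda>n. G (r n) s) \<longlonglongrightarrow> h s"
    "\<And>K. compact K \<Longrightarrow> K \<subseteq> strip \<Theta> \<Longrightarrow> uniform_limit K (G \<circ> r) h sequentially"
  proof (rule Montel[OF open_strip, of "range G" \<Theta> G])
    show "\<exists>B. \<forall>h\<in>range G. \<forall>z\<in>K. cmod (h z) \<le> B" if "K \<subseteq> strip \<Theta>" for K
      using B in_strip that by (intro exI[of _ B]) (auto simp: G_def)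
  qed (use G in auto)
  have real: "h (of_real t) = c" for t
  proof (rule LIMSEQ_unique)
    show "(\<lambda>n. G (r n) (of_real t)) \<longlonglongrightarrow> h (of_real t)"
      using hr(3)[of "of_real t"] \<open>\<Theta> > 0\<close> by (simp add: strip_def)
    show "(\<lambda>n. G (r n) (of_real t)) \<longlonglongrightarrow> c"
      using LIMSEQ_subseq_LIMSEQ[OF lim strict_mono_o[OF p(1) hr(2)], of t] by (simp add: G_def o_def)
  qed
  have h: "h s - c = 0" if "s \<in> strip \<Theta>" for s
  proof (rule analytic_continuation[OF _ open_strip connected_strip, of "\<lambda>s. h s - c" \<Theta> "range of_real" 0])
    have "(0::real) islimpt UNIV" by (simp add: interior_limit_point)
    then show "(0::complex) islimpt range of_real"
      using islimpt_of_real_image[of 0 UNIV] by simp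
  qed (use that \<open>\<Theta> > 0\<close> real hr(1) in \<open>auto intro!: holomorphic_intros simp: strip_def\<close>)
  have "\<forall>\<^sub>F n in sequentially. \<forall>s\<in>K. dist ((G \<circ> r) n s) (h s) < e"
    using hr(4)[OF K] e(1) by (auto simp: uniform_limit_iff)
  then obtain n where "\<forall>s\<in>K. dist (G (r n) s) (h s) < e"
    by (auto simp: eventually_sequentially)
  moreover have "h s = c" if "s \<in> K" for s
    using h K that by auto
  ultimately show False
    using p(2)[of "r n"] by (auto simp: G_def)
qed

lemma integral_tendsto_const_of_uniform_limit:
  fixes h :: "'a \<Rightarrow> real \<Rightarrow> complex"
  assumes u: "uniform_limit {a..b} h (\<lambda>_. c) G" and "a \<le> b"
    and cont: "\<forall>\<^sub>F x in G. continuous_on {a..b} (h x)"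
  shows "((\<lambda>x. integral {a..b} (h x)) \<longlongrightarrow> of_real (b - a) * c) G"
proof (rule tendstoI)
  fix e :: real assume e: "e > 0"
  \<comment> \<open>The added 1 keeps the denominator positive when \<open>a = b\<close> and makes
    the final estimate strict.\<close>
  define d where "d = e / (b - a + 1)"
  have d: "d > 0" using e \<open>a \<le> b\<close> by (simp add: d_def)
  have "\<forall>\<^sub>F x in G. \<forall>t\<in>{a..b}. dist (h x t) c < d"
    using u d by (auto simp: uniform_limit_iff)
  with cont show "\<forall>\<^sub>F x in G. dist (integral {a..b} (h x)) (of_real (b - a) * c) < e"
  proof eventually_elim
    case (elim x)
    have "norm (integral {a..b} (\<lambda>t. h x t - c)) \<le> d * (b - a)"
      using elim \<open>a \<le> b\<close> by (intro integral_bound continuous_intros) (auto simp: dist_norm less_imp_le)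
    also have "\<dots> < d * (b - a + 1)"
      using d by simp
    also have "\<dots> = e" using \<open>a \<le> b\<close> by (simp add: d_def)
    also have "integral {a..b} (\<lambda>t. h x t - c) = integral {a..b} (h x) - of_real (b - a) * c"
      using elim \<open>a \<le> b\<close> by (subst integral_diff) (auto intro!: integrable_continuous_real simp: scaleR_conv_of_real)
    finally show ?case by (simp add: dist_norm)
  qed
qed

section \<open>Limits of the two kernels on vertical segments\<close>

lemma uniform_limit_kernel_at_top:
  "uniform_limit {-pi..pi} (\<lambda>X y. m / (exp (Complex X y) - m)) (\<lambda>_. 0) at_top" (is ?t1)
  "uniform_limit {-pi..pi} (\<lambda>X y. exp (Complex X y) / (exp (Complex X y) - m)) (\<lambda>_. 1) at_top" (is ?t2)
proof -
  \<comment> \<open>The modulus of \<open>exp (Complex X y)\<close> is \<open>exp X\<close>, so the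
    estimate is uniform in \<open>y\<close>. The second kernel exceeds the first by exactly 1, so
    one estimate serves both.\<close>
  have *: "\<forall>\<^sub>F X in at_top. \<forall>y. exp (Complex X y) \<noteq> m \<and> norm (m / (exp (Complex X y) - m)) < e"
    if e: "e > 0" for e
  proof -
    have "\<forall>\<^sub>F X in at_top. cmod m / e + cmod m < exp X"
      using exp_at_top filterlim_at_top_dense by blast
    then show ?thesis
    proof (eventually_elim, intro allI)
      fix X y
      assume X: "cmod m / e + cmod m < exp X"
      have "exp X - cmod m \<le> cmod (exp (Complex X y) - m)"
        using norm_triangle_ineq2[of "exp (Complex X y)" m] by simp
      with X have "cmod m / e < cmod (exp (Complex X y) - m)" by linarith
      moreover from this have "0 < cmod (exp (Complex X y) - m)"
        using e by (smt (verit) divide_nonneg_pos norm_ge_zero)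
      ultimately show "exp (Complex X y) \<noteq> m \<and> norm (m / (exp (Complex X y) - m)) < e"
        using e by (auto simp: norm_divide pos_divide_less_eq mult.commute)
    qed
  qed
  show ?t1
    unfolding uniform_limit_iff
  proof (intro allI impI)
    fix e :: real assume "e > 0"
    from *[OF this] show "\<forall>\<^sub>F X in at_top. \<forall>y\<in>{-pi..pi}. dist (m / (exp (Complex X y) - m)) 0 < e"
      by eventually_elim simp
  qed
  show ?t2
    unfolding uniform_limit_iff
  proof (intro allI impI)
    fix e :: real assume "e > 0"
    from *[OF this] show "\<forall>\<^sub>F X in at_top. \<forall>y\<in>{-pi..pi}. dist (exp (Complex X y) / (exp (Complex X y) - m)) 1 < e"
    proof (eventually_elim, intro ballI)
      fix X y
      assume "\<forall>y. exp (Complex X y) \<noteq> m \<and> norm (m / (exp (Complex X y) - m)) < e"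
      then have "exp (Complex X y) \<noteq> m" "norm (m / (exp (Complex X y) - m)) < e" by auto
      moreover from this have "exp (Complex X y) / (exp (Complex X y) - m) - 1 = m / (exp (Complex X y) - m)"
        by (simp add: divide_simps)
      ultimately show "dist (exp (Complex X y) / (exp (Complex X y) - m)) 1 < e"
        by (simp add: dist_norm)
    qed
  qed
qed

text \<open>At the left end the roles are exchanged: the kernel with \<open>exp\<close> in the
  numerator is estimated directly and the other one is obtained by subtracting 1. Since
  \<open>m\<close> is nonzero, the denominators stay away from 0.\<close>

lemma uniform_limit_kernel_at_bot:
  assumes m: "m \<noteq> 0"
  shows "uniform_limit {-pi..pi} (\<lambda>X y. m / (exp (Complex X y) - m)) (\<lambda>_. -1) at_bot" (is ?t1)
    "uniform_limit {-pi..pi} (\<lambda>X y. exp (Complex X y) / (exp (Complex X y) - m)) (\<lambda>_. 0) at_bot" (is ?t2)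
proof -
  have *: "\<forall>\<^sub>F X in at_bot. \<forall>y. exp (Complex X y) \<noteq> m \<and> norm (exp (Complex X y) / (exp (Complex X y) - m)) < e"
    if e: "e > 0" for e
  proof -
    have "\<forall>\<^sub>F X::real in at_bot. exp X < cmod m * e / (1 + e)"
      using e m by (intro order_tendstoD(2)[OF exp_at_bot]) (auto simp: add_pos_pos)
    then show ?thesis
    proof (eventually_elim, intro allI)
      fix X y
      assume "exp X < cmod m * e / (1 + e)"
      \<comment> \<open>The threshold for \<open>exp X\<close> was found by solving this
        inequality.\<close>
      then have X: "exp X < e * (cmod m - exp X)"
        using e by (simp add: field_simps)
      have le: "cmod m - exp X \<le> cmod (exp (Complex X y) - m)"
        using norm_triangle_ineq2[of m "exp (Complex X y)"] by (simp add: norm_minus_commute)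
      have "0 < e * (cmod m - exp X)"
        using X exp_gt_zero[of X] by linarith
      then have pos: "0 < cmod (exp (Complex X y) - m)"
        using e le by (auto simp: zero_less_mult_iff)
      have "e * (cmod m - exp X) \<le> e * cmod (exp (Complex X y) - m)"
        using e le by (intro mult_left_mono) auto
      with X have "exp X < e * cmod (exp (Complex X y) - m)" by linarith
      with pos show "exp (Complex X y) \<noteq> m \<and> norm (exp (Complex X y) / (exp (Complex X y) - m)) < e"
        by (auto simp: norm_divide pos_divide_less_eq)
    qed
  qed
  show ?t2
    unfolding uniform_limit_iff
  proof (intro allI impI)
    fix e :: real assume "e > 0"
    from *[OF this] show "\<forall>\<^sub>F X in at_bot. \<forall>y\<in>{-pi..pi}. dist (exp (Complex X y) / (exp (Complex X y) - m)) 0 < e"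
      by eventually_elim simp
  qed
  show ?t1
    unfolding uniform_limit_iff
  proof (intro allI impI)
    fix e :: real assume "e > 0"
    from *[OF this] show "\<forall>\<^sub>F X in at_bot. \<forall>y\<in>{-pi..pi}. dist (m / (exp (Complex X y) - m)) (-1) < e"
    proof (eventually_elim, intro ballI)
      fix X y
      assume "\<forall>y. exp (Complex X y) \<noteq> m \<and> norm (exp (Complex X y) / (exp (Complex X y) - m)) < e"
      then have "exp (Complex X y) \<noteq> m" "norm (exp (Complex X y) / (exp (Complex X y) - m)) < e" by auto
      moreover from this have "m / (exp (Complex X y) - m) + 1 = exp (Complex X y) / (exp (Complex X y) - m)"
        by (simp add: divide_simps)
      ultimately show "dist (m / (exp (Complex X y) - m)) (-1) < e"
        by (simp add: dist_norm)
    qed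
  qed
qed

lemma eventually_exp_neq_at_top: "\<forall>\<^sub>F X in at_top. \<forall>y. exp (Complex X y) \<noteq> m"
proof -
  have "\<forall>\<^sub>F X in at_top. cmod m < exp X"
    using exp_at_top filterlim_at_top_dense by blast
  then show ?thesis
    by eventually_elim (metis complex.sel(1) less_irrefl norm_exp_eq_Re)
qed

lemma eventually_exp_neq_at_bot:
  assumes "m \<noteq> 0"
  shows "\<forall>\<^sub>F X in at_bot. \<forall>y. exp (Complex X y) \<noteq> m"
proof -
  have "\<forall>\<^sub>F X::real in at_bot. exp X < cmod m"
    using assms by (intro order_tendstoD(2)[OF exp_at_bot]) auto
  then show ?thesis
    by eventually_elim (metis complex.sel(1) less_irrefl norm_exp_eq_Re)
qed

lemma continuous_on_side:
  assumes F: "F holomorphic_on strip \<Theta>" and "pi < \<Theta>"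
  shows "continuous_on {-pi..pi} (\<lambda>y. F (Complex X y))"
  unfolding Complex_eq
  by (rule continuous_on_compose2[OF holomorphic_on_imp_continuous_on[OF F]])
    (use assms in \<open>auto intro!: continuous_intros simp: strip_def\<close>)

text \<open>Boundedness of \<open>F\<close> suffices here, with no radial limit, because the kernel
  decays uniformly. The filter is left general so that either end of the strip can be
  treated.\<close>

lemma side_integral_vanishes:
  fixes F k :: "complex \<Rightarrow> complex"
  assumes F: "F holomorphic_on strip \<Theta>" and B: "\<And>s. s \<in> strip \<Theta> \<Longrightarrow> norm (F s) \<le> B" and \<Theta>: "pi < \<Theta>"
    and k: "uniform_limit {-pi..pi} (\<lambda>X y. k (Complex X y)) (\<lambda>_. 0) G"
    and cont: "\<forall>\<^sub>F X in G. continuous_on {-pi..pi} (\<lambda>y. k (Complex X y))"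
  shows "((\<lambda>X. integral {-pi..pi} (\<lambda>y. F (Complex X y) * k (Complex X y))) \<longlongrightarrow> 0) G"
proof -
  have "uniform_limit {-pi..pi} (\<lambda>X y. F (Complex X y) * k (Complex X y)) (\<lambda>_. 0) G"
    unfolding uniform_limit_iff
  proof (intro allI impI)
    fix e :: real assume e: "e > 0"
    define d where "d = e / (\<bar>B\<bar> + 1)"
    have d: "d > 0" "d * (\<bar>B\<bar> + 1) = e" using e by (auto simp: d_def)
    have "\<forall>\<^sub>F X in G. \<forall>y\<in>{-pi..pi}. dist (k (Complex X y)) 0 < d"
      using k d by (auto simp: uniform_limit_iff)
    then show "\<forall>\<^sub>F X in G. \<forall>y\<in>{-pi..pi}. dist (F (Complex X y) * k (Complex X y)) 0 < e"
    proof (eventually_elim, intro ballI)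
      fix X y
      assume "\<forall>y\<in>{-pi..pi}. dist (k (Complex X y)) 0 < d" and y: "y \<in> {-pi..pi}"
      then have 1: "norm (k (Complex X y)) < d" by auto
      have 2: "norm (F (Complex X y)) \<le> \<bar>B\<bar>"
        using order_trans[OF B abs_ge_self] y \<Theta> by (auto simp: strip_def)
      have "norm (F (Complex X y)) * norm (k (Complex X y)) \<le> \<bar>B\<bar> * d"
        using 1 2 by (intro mult_mono) auto
      also have "\<dots> < e" using d by (simp add: algebra_simps)
      finally show "dist (F (Complex X y) * k (Complex X y)) 0 < e"
        by (simp add: norm_mult)
    qed
  qed
  moreover have "\<forall>\<^sub>F X in G. continuous_on {-pi..pi} (\<lambda>y. F (Complex X y) * k (Complex X y))"
    using cont by eventually_elim (intro continuous_intros continuous_on_side[OF F \<Theta>])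
  ultimately show ?thesis
    using integral_tendsto_const_of_uniform_limit[where a = "-pi" and b = pi and c = 0] by simp
qed

text \<open>The normal-family argument works along sequences, so the limit is first taken along one.
  Since \<open>\<Theta>\<close> exceeds \<open>pi\<close>, the closed vertical segment is compact
  inside the strip, and \<open>2 * pi\<close> is its length.\<close>

lemma side_integral_LIMSEQ:
  fixes F k :: "complex \<Rightarrow> complex" and c d :: complex
  assumes F: "F holomorphic_on strip \<Theta>" and B: "\<And>s. s \<in> strip \<Theta> \<Longrightarrow> norm (F s) \<le> B" and \<Theta>: "pi < \<Theta>"
    and lim: "\<And>t. (\<lambda>n. F (of_real (X n + t))) \<longlonglongrightarrow> c"
    and k: "uniform_limit {-pi..pi} (\<lambda>n y. k (Complex (X n) y)) (\<lambda>_. d) sequentially"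
    and cont: "\<forall>\<^sub>F n in sequentially. continuous_on {-pi..pi} (\<lambda>y. k (Complex (X n) y))"
  shows "(\<lambda>n. integral {-pi..pi} (\<lambda>y. F (Complex (X n) y) * k (Complex (X n) y))) \<longlonglongrightarrow> 2 * pi * (c * d)"
proof -
  have "uniform_limit ((\<lambda>y. \<i> * of_real y) ` {-pi..pi}) (\<lambda>n s. F (of_real (X n) + s)) (\<lambda>_. c) sequentially"
    using \<Theta> less_trans[OF pi_gt_zero \<Theta>]
    by (intro strip_uniform_limit[OF F B lim] compact_continuous_image continuous_intros compact_Icc)
      (auto simp: strip_def)
  then have "uniform_limit {-pi..pi} (\<lambda>n y. F (Complex (X n) y)) (\<lambda>_. c) sequentially"
    by (simp add: uniform_limit_iff Complex_eq)
  then have "uniform_limit {-pi..pi} (\<lambda>n y. F (Complex (X n) y) * k (Complex (X n) y)) (\<lambda>_. c * d) sequentially"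
    using k by (rule uniform_lim_mult) (auto simp: image_constant_conv)
  moreover have "\<forall>\<^sub>F n in sequentially. continuous_on {-pi..pi} (\<lambda>y. F (Complex (X n) y) * k (Complex (X n) y))"
    using cont by eventually_elim (intro continuous_intros continuous_on_side[OF F \<Theta>])
  ultimately show ?thesis
    using integral_tendsto_const_of_uniform_limit[where a = "-pi" and b = pi and c = "c * d" and G = sequentially] by simp
qed

lemma side_integral_tendsto_at_top:
  fixes F k :: "complex \<Rightarrow> complex" and c d :: complex
  assumes F: "F holomorphic_on strip \<Theta>" and B: "\<And>s. s \<in> strip \<Theta> \<Longrightarrow> norm (F s) \<le> B" and \<Theta>: "pi < \<Theta>"
    and lim: "((\<lambda>x. F (of_real x)) \<longlongrightarrow> c) at_top"
    and k: "uniform_limit {-pi..pi} (\<lambda>X y. k (Complex X y)) (\<lambda>_. d) at_top"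
    and cont: "\<forall>\<^sub>F X in at_top. continuous_on {-pi..pi} (\<lambda>y. k (Complex X y))"
  shows "((\<lambda>X. integral {-pi..pi} (\<lambda>y. F (Complex X y) * k (Complex X y))) \<longlongrightarrow> 2 * pi * (c * d)) at_top"
proof (rule tendsto_at_topI_sequentially)
  fix X :: "nat \<Rightarrow> real" assume X: "filterlim X at_top sequentially"
  show "(\<lambda>n. integral {-pi..pi} (\<lambda>y. F (Complex (X n) y) * k (Complex (X n) y))) \<longlonglongrightarrow> 2 * pi * (c * d)"
  proof (rule side_integral_LIMSEQ[OF F B \<Theta>])
    fix t
    \<comment> \<open>A fixed shift does not affect divergence, so the single radial limit supplies
      the limits for all \<open>t\<close>.\<close>
    have "filterlim (\<lambda>n. t + X n) at_top sequentially"
      by (rule filterlim_tendsto_add_at_top[OF tendsto_const X])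
    from filterlim_compose[OF lim this]
    show "(\<lambda>n. F (of_real (X n + t))) \<longlonglongrightarrow> c" by (simp add: add.commute)
  qed (use filterlim_compose[OF k X] eventually_compose_filterlim[OF cont X] in auto)
qed

lemma side_integral_tendsto_at_bot:
  fixes F k :: "complex \<Rightarrow> complex" and c d :: complex
  assumes F: "F holomorphic_on strip \<Theta>" and B: "\<And>s. s \<in> strip \<Theta> \<Longrightarrow> norm (F s) \<le> B" and \<Theta>: "pi < \<Theta>"
    and lim: "((\<lambda>x. F (of_real x)) \<longlongrightarrow> c) at_bot"
    and k: "uniform_limit {-pi..pi} (\<lambda>X y. k (Complex X y)) (\<lambda>_. d) at_bot"
    and cont: "\<forall>\<^sub>F X in at_bot. continuous_on {-pi..pi} (\<lambda>y. k (Complex X y))"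
  shows "((\<lambda>X. integral {-pi..pi} (\<lambda>y. F (Complex X y) * k (Complex X y))) \<longlongrightarrow> 2 * pi * (c * d)) at_bot"
proof (rule tendsto_at_botI_sequentially)
  fix X :: "nat \<Rightarrow> real" assume X: "filterlim X at_bot sequentially"
  show "(\<lambda>n. integral {-pi..pi} (\<lambda>y. F (Complex (X n) y) * k (Complex (X n) y))) \<longlonglongrightarrow> 2 * pi * (c * d)"
  proof (rule side_integral_LIMSEQ[OF F B \<Theta>])
    fix t
    have "filterlim (\<lambda>n. t + X n) at_bot sequentially"
      using X by (subst filterlim_tendsto_add_at_bot_iff[OF tendsto_const])
    from filterlim_compose[OF lim this]
    show "(\<lambda>n. F (of_real (X n + t))) \<longlonglongrightarrow> c" by (simp add: add.commute)
  qed (use filterlim_compose[OF k X] eventually_compose_filterlim[OF cont X] in auto)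
qed

section \<open>The integral formula\<close>

text \<open>For endpoints enclosing \<open>Re l\<close> the residue identity gives the integral
  exactly. Each vertical side depends on only one endpoint, so their limits \<open>\<alpha>\<close>
  and \<open>\<beta>\<close> may be taken independently, as the improper integral demands.\<close>

lemma has_improper_integral_strip:
  assumes F: "F holomorphic_on strip \<Theta>" and H: "H holomorphic_on strip \<Theta>"
    and \<Theta>: "pi < \<Theta>" "\<Theta> + \<bar>Im l\<bar> \<le> 2 * pi"
    and l: "H l = exp l" and q: "q > 0" and c: "c \<noteq> 0"
    and \<phi>: "continuous_on {0<..} \<phi>"
  defines "K \<equiv> \<lambda>s. F s * H s / (exp s - exp l)"
  assumes eq: "\<And>t. t > 0 \<Longrightarrow>
      K (Complex (q * ln t) (-pi)) - K (Complex (q * ln t) pi) = c * (of_real (t / q) * \<phi> t)"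
    and \<alpha>: "((\<lambda>X. integral {-pi..pi} (\<lambda>y. K (Complex X y))) \<longlongrightarrow> \<alpha>) at_top"
    and \<beta>: "((\<lambda>X. integral {-pi..pi} (\<lambda>y. K (Complex X y))) \<longlongrightarrow> \<beta>) at_bot"
  shows "has_improper_integral \<phi> ((2 * pi * \<i> * F l - \<i> * (\<alpha> - \<beta>)) / c)"
proof -
  define A where "A = (\<lambda>X. integral {-pi..pi} (\<lambda>y. K (Complex X y)))"
  have int: "integral {a..b} \<phi> = (2 * pi * \<i> * F l - \<i> * (A (q * ln b) - A (q * ln a))) / c"
    if ab: "0 < a" "q * ln a < Re l" "Re l < q * ln b" "0 < b" for a b
  proof -
    have less: "q * ln a < q * ln b" using ab by linarith
    \<comment> \<open>Substitution \<open>t = exp (x / q)\<close>; its derivative is the factor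
      \<open>t / q\<close> in the hypothesis \<open>eq\<close>.\<close>
    have "((\<lambda>x. (exp (x / q) / q) *\<^sub>R \<phi> (exp (x / q))) has_integral
        integral {exp (q * ln a / q)..exp (q * ln b / q)} \<phi>) {q * ln a..q * ln b}"
    proof (rule has_integral_substitution[where c = a and d = b])
      show "(\<lambda>x. exp (x / q)) ` {q * ln a..q * ln b} \<subseteq> {a..b}"
      proof clarify
        fix x assume "x \<in> {q * ln a..q * ln b}"
        then have "ln a \<le> x / q" "x / q \<le> ln b"
          using q by (auto simp: field_simps)
        then show "exp (x / q) \<in> {a..b}"
          using ab by (metis atLeastAtMost_iff exp_le_cancel_iff exp_ln)
      qed
      show "continuous_on {a..b} \<phi>"
        using ab by (intro continuous_on_subset[OF \<phi>]) auto
    qed (use q less in \<open>auto intro!: derivative_eq_intros divide_right_mono\<close>)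
    then have "((\<lambda>x. c * (of_real (exp (x / q) / q) * \<phi> (exp (x / q)))) has_integral c * integral {a..b} \<phi>)
        {q * ln a..q * ln b}"
      using q ab by (intro has_integral_mult_right) (simp add: scaleR_conv_of_real)
    moreover have "K (Complex x (-pi)) - K (Complex x pi) = c * (of_real (exp (x / q) / q) * \<phi> (exp (x / q)))" for x
      using eq[of "exp (x / q)"] q by simp
    ultimately have "integral {q * ln a..q * ln b} (\<lambda>x. K (Complex x (-pi)) - K (Complex x pi)) = c * integral {a..b} \<phi>"
      by (simp only: integral_unique)
    moreover have "integral {q * ln a..q * ln b} (\<lambda>x. K (Complex x (-pi)) - K (Complex x pi)) +
        \<i> * (A (q * ln b) - A (q * ln a)) = 2 * pi * \<i> * F l"
      unfolding A_def K_def by (rule strip_residue[OF F H \<Theta> ab(2,3) l])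
    ultimately show ?thesis
      using c by (simp add: field_simps)
  qed
  let ?G = "at_right (0::real) \<times>\<^sub>F (at_top :: real filter)"
  have bot: "filterlim (\<lambda>p. q * ln (fst p)) at_bot ?G"
    by (rule filterlim_tendsto_pos_mult_at_bot[OF tendsto_const q filterlim_compose[OF ln_at_0 filterlim_fst]])
  have top: "filterlim (\<lambda>p. q * ln (snd p)) at_top ?G"
    by (rule filterlim_tendsto_pos_mult_at_top[OF tendsto_const q filterlim_compose[OF ln_at_top filterlim_snd]])
  have "((\<lambda>p. (2 * pi * \<i> * F l - \<i> * (A (q * ln (snd p)) - A (q * ln (fst p)))) / c) \<longlongrightarrow>
      (2 * pi * \<i> * F l - \<i> * (\<alpha> - \<beta>)) / c) ?G"
    using c filterlim_compose[OF \<alpha> top] filterlim_compose[OF \<beta> bot]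
    by (intro tendsto_intros) (auto simp: A_def)
  moreover have "\<forall>\<^sub>F p in ?G. (2 * pi * \<i> * F l - \<i> * (A (q * ln (snd p)) - A (q * ln (fst p)))) / c =
      (case p of (a, b) \<Rightarrow> integral {a..b} \<phi>)"
  proof -
    have "\<forall>\<^sub>F p in ?G. q * ln (fst p) < Re l"
      using bot by (auto simp: filterlim_at_bot_dense)
    moreover have "\<forall>\<^sub>F p in ?G. Re l < q * ln (snd p)"
      using top by (auto simp: filterlim_at_top_dense)
    moreover have "\<forall>\<^sub>F p in ?G. 0 < fst p"
      by (rule eventually_compose_filterlim[OF eventually_at_right_less filterlim_fst])
    moreover have "\<forall>\<^sub>F p in ?G. 0 < snd p"
      by (rule eventually_compose_filterlim[OF eventually_gt_at_top filterlim_snd])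
    ultimately show ?thesis
      by eventually_elim (auto simp: int split: prod.split)
  qed
  ultimately have "((\<lambda>(a, b). integral {a..b} \<phi>) \<longlongrightarrow> (2 * pi * \<i> * F l - \<i> * (\<alpha> - \<beta>)) / c) ?G"
    by (rule Lim_transform_eventually)
  moreover have "\<phi> integrable_on {a..b}" if "0 < a" for a b
    using that by (intro integrable_continuous_real continuous_on_subset[OF \<phi>]) auto
  ultimately show ?thesis
    by (auto simp: has_improper_integral_def)
qed

text \<open>An infinite limit sends the inverse to 0, matching the convention in
  \<open>recip_add\<close>. For a finite limit \<open>r\<close>, continuity of the inverse needs
  \<open>z + r\<close> nonzero, which holds because \<open>z\<close> is neither 0 nor a negative
  real.\<close>

lemma inverse_add_tendsto_recip_add:
  assumes z: "z \<noteq> 0" "\<bar>Arg z\<bar> < pi" and g: "\<forall>\<^sub>F t in G. g t = of_real (Re (g t)) \<and> 0 \<le> Re (g t)"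
    and lim: "((\<lambda>t. ennreal (Re (g t))) \<longlongrightarrow> L) G"
  shows "((\<lambda>t. inverse (z + g t)) \<longlongrightarrow> recip_add z L) G"
proof -
  have "((\<lambda>t. inverse (z + of_real (Re (g t)))) \<longlongrightarrow> recip_add z L) G"
  proof (cases L)
    case top
    then have "filterlim (\<lambda>t. Re (g t)) at_top G"
      using lim by (simp add: ennreal_tendsto_top_eq_at_top)
    then have "filterlim (\<lambda>t. complex_of_real (Re (g t))) at_infinity G"
      by (rule filterlim_compose[OF filterlim_of_real_at_infinity])
    then have "filterlim (\<lambda>t. z + complex_of_real (Re (g t))) at_infinity G"
      by (rule tendsto_add_filterlim_at_infinity[OF tendsto_const])
    then show ?thesis
      using filterlim_compose[OF tendsto_inverse_0] top by (auto simp: recip_add_def)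
  next
    case (real r)
    have "z + of_real r \<noteq> 0"
    proof
      assume "z + of_real r = 0"
      then have "z = of_real (-r)" by (simp add: eq_neg_iff_add_eq_0)
      with z real have "Arg z = pi" using Arg_of_real[of "-r"] by auto
      with z show False by simp
    qed
    moreover have "((\<lambda>t. Re (g t)) \<longlongrightarrow> r) G"
      using lim real g by (auto elim!: eventually_mono intro!: tendsto_ennrealD)
    ultimately show ?thesis
      using real unfolding recip_add_def by (auto simp: divide_inverse intro!: tendsto_intros)
  qed
  moreover have "\<forall>\<^sub>F t in G. inverse (z + of_real (Re (g t))) = inverse (z + g t)"
    using g by eventually_elim auto
  ultimately show ?thesis
    by (rule Lim_transform_eventually)
qed

section \<open>The resolvent transplanted to the strip\<close>

lemma Arg_exp_scaled:
  assumes "q > 0" "\<bar>Im s\<bar> < q * pi"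
  shows "Arg (exp (s / of_real q)) = Im s / q"
proof -
  have "- pi < Im s / q" "Im s / q < pi"
    using assms by (auto simp: abs_less_iff field_simps)
  then show ?thesis by (subst Arg_exp) auto
qed

lemma Re_exp_scaled_pos:
  assumes "q > 0" "\<bar>Im s\<bar> < q * (pi / 2)"
  shows "Re (exp (s / of_real q)) > 0"
proof -
  have "- (pi / 2) < Im s / q" "Im s / q < pi / 2"
    using assms by (auto simp: abs_less_iff field_simps)
  then show ?thesis
    by (auto simp: Re_exp intro!: mult_pos_pos cos_gt_zero_pi)
qed

text \<open>The map \<open>exp (s / q)\<close> sends the strip into the sector of half-angle
  \<open>\<Theta> / q\<close>, inside the right half-plane. As \<open>f\<close> does not increase
  the modulus of the argument, the arguments of \<open>z\<close> and of the value of
  \<open>f\<close> add up to less than \<open>pi\<close> in modulus, and \<open>cmod_add_ge\<close>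
  applies.\<close>

lemma resolvent_strip:
  assumes f: "f \<in> NP_plus" and q: "q > 0" and z: "z \<noteq> 0"
    and \<Theta>: "0 < \<Theta>" "\<Theta> \<le> q * (pi / 2)" "\<bar>Arg z\<bar> + \<Theta> / q < pi"
  defines "F \<equiv> \<lambda>s. inverse (z + f (exp (s / of_real q)))"
  shows "s \<in> strip \<Theta> \<Longrightarrow> norm (F s) \<le> inverse (cmod z * sin (\<bar>Arg z\<bar> + \<Theta> / q))"
    and "s \<in> strip \<Theta> \<Longrightarrow> z + f (exp (s / of_real q)) \<noteq> 0"
    and "F holomorphic_on strip \<Theta>"
proof -
  define \<gamma> where "\<gamma> = \<bar>Arg z\<bar> + \<Theta> / q"
  have \<gamma>: "0 < \<gamma>" "\<gamma> < pi"
    using q \<Theta> by (auto simp: \<gamma>_def add_nonneg_pos)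
  have pos: "0 < cmod z * sin \<gamma>"
    using z \<gamma> by (simp add: sin_gt_zero)
  have Re: "Re (exp (s / of_real q)) > 0" if "s \<in> strip \<Theta>" for s
    using Re_exp_scaled_pos[OF q] that \<Theta> by (auto simp: strip_def)
  have le: "cmod z * sin \<gamma> \<le> cmod (z + f (exp (s / of_real q)))" if s: "s \<in> strip \<Theta>" for s
  proof (rule cmod_add_ge)
    have "q * (pi / 2) < q * pi" using q by simp
    then have "\<bar>Im s\<bar> < q * pi"
      using s \<Theta> unfolding strip_def by (simp only: mem_Collect_eq)
    then have "\<bar>Arg (exp (s / of_real q))\<bar> \<le> \<Theta> / q"
      using s q by (simp add: Arg_exp_scaled strip_def divide_right_mono less_imp_le)
    then show "\<bar>Arg z\<bar> + \<bar>Arg (f (exp (s / of_real q)))\<bar> \<le> \<gamma>"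
      using NP_plus_Arg_le[OF f Re[OF s]] by (simp add: \<gamma>_def)
  qed (use \<gamma> in auto)
  show "norm (F s) \<le> inverse (cmod z * sin (\<bar>Arg z\<bar> + \<Theta> / q))" if "s \<in> strip \<Theta>"
    using le[OF that] pos unfolding F_def norm_inverse \<gamma>_def by (rule le_imp_inverse_le)
  have ne: "z + f (exp (s / of_real q)) \<noteq> 0" if "s \<in> strip \<Theta>" for s
    using le[OF that] pos by auto
  then show "s \<in> strip \<Theta> \<Longrightarrow> z + f (exp (s / of_real q)) \<noteq> 0" .
  have "(\<lambda>s. f (exp (s / of_real q))) holomorphic_on strip \<Theta>"
    by (rule holomorphic_on_compose_gen[OF _ NP_plus_holomorphic[OF f], unfolded o_def])
      (use Re q in \<open>auto intro!: holomorphic_intros\<close>)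
  then show "F holomorphic_on strip \<Theta>"
    unfolding F_def using ne by (intro holomorphic_intros) auto
qed

text \<open>The conditions on \<open>\<Theta>\<close> respectively place the contour inside the
  strip, exclude further poles, keep \<open>exp (s / q)\<close> in the half-plane and bound the
  resolvent. The hypotheses put every upper bound strictly above \<open>pi\<close>, which leaves
  room for \<open>\<Theta>\<close>.\<close>

lemma strip_width_exists:
  assumes "q > 2" "\<bar>Arg z\<bar> < pi - pi / q" "\<bar>y\<bar> < pi"
  obtains \<Theta> where "pi < \<Theta>" "\<Theta> + \<bar>y\<bar> \<le> 2 * pi" "\<Theta> \<le> q * (pi / 2)" "\<bar>Arg z\<bar> + \<Theta> / q < pi"
proof -
  have "pi < q * (pi - \<bar>Arg z\<bar>)" using assms by (simp add: field_simps)
  moreover have "pi < q * (pi / 2)" using assms by (simp add: field_simps)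
  ultimately have "pi < min (min (2 * pi - \<bar>y\<bar>) (q * (pi / 2))) (q * (pi - \<bar>Arg z\<bar>))"
    using assms by auto
  then obtain \<Theta> where "pi < \<Theta>" "\<Theta> < min (min (2 * pi - \<bar>y\<bar>) (q * (pi / 2))) (q * (pi - \<bar>Arg z\<bar>))"
    using dense by blast
  with that[of \<Theta>] assms show ?thesis by (simp add: field_simps)
qed

section \<open>The two integral formulas for fixed data\<close>

locale resolvent_formula =
  fixes f :: "complex \<Rightarrow> complex" and q :: real and \<mu> z :: complex and \<Theta> :: real
  assumes f: "f \<in> NP_plus"
    and q: "q > 2"
    and \<mu>: "\<mu> \<noteq> 0" "\<bar>Arg \<mu>\<bar> < pi / q"
    and z: "z \<noteq> 0" "\<bar>Arg z\<bar> < pi - pi / q"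
    and \<Theta>: "pi < \<Theta>" "\<Theta> + \<bar>q * Arg \<mu>\<bar> \<le> 2 * pi" "\<Theta> \<le> q * (pi / 2)" "\<bar>Arg z\<bar> + \<Theta> / q < pi"
begin

text \<open>The pole: \<open>exp (l / q)\<close> is \<open>\<mu>\<close> and \<open>exp l\<close> is
  \<open>m\<close>. Below, \<open>F\<close> is the transplanted resolvent, and \<open>u\<close>,
  \<open>v\<close> are the values of \<open>f\<close> on the two rays that correspond to the heights
  \<open>pi\<close> and \<open>- pi\<close>.\<close>

definition l :: complex where "l = of_real q * Ln \<mu>"
definition m :: complex where "m = \<mu> powr of_real q"
definition F :: "complex \<Rightarrow> complex" where "F = (\<lambda>s. inverse (z + f (exp (s / of_real q))))"
definition u :: "real \<Rightarrow> complex" where "u = (\<lambda>t. f (of_real t * cis (pi / q)))"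
definition v :: "real \<Rightarrow> complex" where "v = (\<lambda>t. f (of_real t * cis (- (pi / q))))"

lemma q_pos: "q > 0"
  using q by simp

lemma exp_l: "exp l = m"
  using \<mu> by (simp add: l_def m_def powr_def)

lemma m_nonzero: "m \<noteq> 0"
  using exp_l by auto

lemma Im_l: "Im l = q * Arg \<mu>"
  using \<mu> by (simp add: l_def Arg_eq_Im_Ln)

lemma Im_l_less: "\<bar>Im l\<bar> < pi"
  using \<Theta> by (simp add: Im_l)

lemma \<Theta>_l: "\<Theta> + \<bar>Im l\<bar> \<le> 2 * pi"
  using \<Theta> by (simp add: Im_l)

lemma \<Theta>_pos: "0 < \<Theta>"
  using less_trans[OF pi_gt_zero \<Theta>(1)] .

lemmas resolvent = resolvent_strip[OF f q_pos z(1) \<Theta>_pos \<Theta>(3,4)]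

lemma F_holomorphic: "F holomorphic_on strip \<Theta>"
  unfolding F_def by (rule resolvent(3))

lemma F_bound: "s \<in> strip \<Theta> \<Longrightarrow> norm (F s) \<le> inverse (cmod z * sin (\<bar>Arg z\<bar> + \<Theta> / q))"
  unfolding F_def by (rule resolvent(1))

lemma F_l: "F l = inverse (z + f \<mu>)"
  using \<mu> q by (simp add: F_def l_def)

lemma exp_side:
  assumes "t > 0"
  shows "exp (Complex (q * ln t) y / of_real q) = of_real t * cis (y / q)"
  using assms q by (simp add: exp_eq_polar Re_divide_of_real Im_divide_of_real)

lemma side_in_strip: "Complex x pi \<in> strip \<Theta>" "Complex x (-pi) \<in> strip \<Theta>"
  using \<Theta> by (auto simp: strip_def)

lemma F_side:
  assumes "t > 0"
  shows "F (Complex (q * ln t) pi) = inverse (z + u t)" "F (Complex (q * ln t) (-pi)) = inverse (z + v t)"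
  by (auto simp: F_def u_def v_def exp_side[OF assms])

lemma denominator_nonzero:
  assumes "t > 0"
  shows "z + u t \<noteq> 0" "z + v t \<noteq> 0"
  using resolvent(2)[OF side_in_strip(1)[of "q * ln t"]] resolvent(2)[OF side_in_strip(2)[of "q * ln t"]]
  by (auto simp: u_def v_def exp_side[OF assms])

lemma Re_ray_pos:
  assumes "t > 0" "y \<in> {pi / q, - (pi / q)}"
  shows "Re (of_real t * cis y) > 0"
proof -
  have "pi / q < pi / 2" using q by (simp add: field_simps)
  moreover have "\<bar>y\<bar> = pi / q" using assms q by auto
  ultimately have "- (pi / 2) < y" "y < pi / 2" by linarith+
  then have "cos y > 0" by (rule cos_gt_zero_pi)
  then show ?thesis using assms by simp
qed

lemma v_eq_cnj: "t > 0 \<Longrightarrow> v t = cnj (u t)"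
  using NP_plus_cnj[OF f Re_ray_pos[of t "pi / q"]] by (simp add: u_def v_def cis_cnj)

text \<open>By reflection \<open>u t\<close> and \<open>v t\<close> are conjugate, so the difference
  of the two resolvents has \<open>u t - v t\<close>, twice the imaginary part times
  \<open>\<i>\<close>, in its numerator.\<close>

lemma resolvent_jump:
  assumes "t > 0"
  shows "inverse (z + v t) - inverse (z + u t) = 2 * \<i> * of_real (Im (u t)) / ((z + u t) * (z + v t))"
proof -
  have "u t - v t = 2 * \<i> * of_real (Im (u t))"
    using complex_diff_cnj[of "u t"] by (simp add: v_eq_cnj[OF assms])
  then show ?thesis
    using denominator_nonzero[OF assms] by (simp add: field_simps)
qed

lemma exp_horizontal:
  assumes "t > 0"
  shows "exp (Complex (q * ln t) pi) = - of_real (t powr q)" "exp (Complex (q * ln t) (-pi)) = - of_real (t powr q)"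
  using assms by (simp_all add: exp_eq_polar powr_def mult.commute flip: cis_cnj)

text \<open>\<open>- (t powr q)\<close> is a value of \<open>exp\<close> at height
  \<open>pi\<close>, whereas \<open>l\<close> lies strictly below that height; injectivity of
  \<open>exp\<close> then separates it from \<open>m\<close>.\<close>

lemma m_plus_powr_nonzero:
  assumes "t > 0"
  shows "m + of_real (t powr q) \<noteq> 0"
proof
  assume "m + of_real (t powr q) = 0"
  then have "exp l = exp (Complex (q * ln t) pi)"
    unfolding exp_horizontal[OF assms] exp_l by (simp add: eq_neg_iff_add_eq_0)
  moreover have "\<bar>Im l\<bar> + \<bar>Im (Complex (q * ln t) pi)\<bar> < 2 * pi"
    using Im_l_less by simp
  ultimately have "l = Complex (q * ln t) pi" by (rule exp_eq_in_strip)
  then have "Im l = pi" by (simp only: complex.sel)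
  with Im_l_less show False by simp
qed

lemma kernel_side: "x / (- of_real (t powr q) - m) = - (x / (m + of_real (t powr q)))"
proof -
  have "- of_real (t powr q) - m = - (m + of_real (t powr q))" by simp
  then show ?thesis by (simp only: minus_divide_right)
qed

lemma continuous_on_ray: "continuous_on {0<..} u" "continuous_on {0<..} v"
  unfolding u_def v_def
  by (rule continuous_on_compose2[OF holomorphic_on_imp_continuous_on[OF NP_plus_holomorphic[OF f]]];
      use Re_ray_pos in \<open>auto intro!: continuous_intros\<close>)+

lemma continuous_on_kernel_side:
  fixes H :: "complex \<Rightarrow> complex"
  assumes "\<forall>y. exp (Complex X y) \<noteq> m" "continuous_on UNIV H"
  shows "continuous_on {-pi..pi} (\<lambda>y. H (Complex X y) / (exp (Complex X y) - m))"
  unfolding Complex_eq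
  by (intro continuous_intros continuous_on_compose2[OF assms(2)])
    (use assms(1) in \<open>auto simp: Complex_eq\<close>)

lemmas kernel_continuous_at_top = eventually_mono[OF eventually_exp_neq_at_top[of m] continuous_on_kernel_side]

lemmas kernel_continuous_at_bot = eventually_mono[OF eventually_exp_neq_at_bot[OF m_nonzero] continuous_on_kernel_side]

lemma exp_strip: "exp holomorphic_on strip \<Theta>" "continuous_on UNIV (exp :: complex \<Rightarrow> complex)"
  by (intro holomorphic_intros continuous_intros)+

lemma f_of_real_nonneg:
  "t > 0 \<Longrightarrow> f (of_real t) = of_real (Re (f (of_real t))) \<and> 0 \<le> Re (f (of_real t))"
  using NP_plus_of_real[OF f, of t] NP_plus_Re_pos[OF f, of "of_real t"] by auto

lemma Arg_z_less: "\<bar>Arg z\<bar> < pi"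
  using z(2) q by (smt (verit) divide_pos_pos pi_gt_zero)

lemma F_of_real: "F (of_real x) = inverse (z + f (of_real (exp (x / q))))"
  by (simp add: F_def exp_of_real flip: of_real_divide)

text \<open>The kernel \<open>exp s / (exp s - m)\<close> tends to 1 on the right and to 0 on the
  left. Hence the right side contributes the limit of \<open>F\<close> at infinity, and the left
  side vanishes without any knowledge of \<open>f\<close> near 0.\<close>

lemma resolvent_formula_at_infinity:
  assumes L: "has_limit_at_infinity f L"
  shows "\<exists>I. has_improper_integral
            (\<lambda>t. of_real (Im (f (of_real t * cis (pi / q)))) * of_real (t powr (q - 1)) /
                 ((z + f (of_real t * cis (pi / q))) * (z + f (of_real t * cis (- (pi / q)))) *
                  (\<mu> powr of_real q + of_real (t powr q)))) I \<and>
          inverse (z + f \<mu>) = recip_add z L + of_real (q / pi) * I"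
proof -
  have "((\<lambda>t. inverse (z + f (of_real t))) \<longlongrightarrow> recip_add z L) at_top"
    using L f_of_real_nonneg unfolding has_limit_at_infinity_def
    by (intro inverse_add_tendsto_recip_add z Arg_z_less) (auto intro: eventually_mono[OF eventually_gt_at_top[of 0]])
  moreover have "LIM x at_top. exp (x / q) :> at_top"
    using filterlim_tendsto_pos_mult_at_top[OF tendsto_const _ filterlim_ident, of "1 / q"] q
    by (intro filterlim_compose[OF exp_at_top]) simp
  ultimately have lim: "((\<lambda>x. F (of_real x)) \<longlongrightarrow> recip_add z L) at_top"
    unfolding F_of_real by (rule filterlim_compose)
  let ?\<phi> = "\<lambda>t. of_real (Im (u t)) * of_real (t powr (q - 1)) / ((z + u t) * (z + v t) * (m + of_real (t powr q)))"
  \<comment> \<open>The value from \<open>has_improper_integral_strip\<close> with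
    \<open>c = 2 * \<i> * q\<close>: the factor \<open>2 * \<i>\<close> comes from the resolvent
    jump, and \<open>q\<close> compensates for the substitution.\<close>
  let ?I = "(2 * pi * \<i> * F l - \<i> * (2 * pi * (recip_add z L * 1) - 0)) / (2 * \<i> * of_real q)"
  have "has_improper_integral ?\<phi> ?I"
  proof (rule has_improper_integral_strip[OF F_holomorphic exp_strip(1) \<Theta>(1) \<Theta>_l refl q_pos])
    show "continuous_on {0<..} ?\<phi>"
      using denominator_nonzero m_plus_powr_nonzero by (intro continuous_intros continuous_on_ray) auto
    show "((\<lambda>X. integral {-pi..pi} (\<lambda>y. F (Complex X y) * exp (Complex X y) / (exp (Complex X y) - exp l)))
        \<longlongrightarrow> 2 * pi * (recip_add z L * 1)) at_top"
      using side_integral_tendsto_at_top[where k = "\<lambda>s. exp s / (exp s - m)",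
          OF F_holomorphic F_bound \<Theta>(1) lim uniform_limit_kernel_at_top(2)
            kernel_continuous_at_top[OF _ exp_strip(2)]]
      by (simp add: exp_l)
    show "((\<lambda>X. integral {-pi..pi} (\<lambda>y. F (Complex X y) * exp (Complex X y) / (exp (Complex X y) - exp l)))
        \<longlongrightarrow> 0) at_bot"
      using side_integral_vanishes[where k = "\<lambda>s. exp s / (exp s - m)",
          OF F_holomorphic F_bound \<Theta>(1) uniform_limit_kernel_at_bot(2)[OF m_nonzero]
            kernel_continuous_at_bot[OF _ exp_strip(2)]]
      by (simp add: exp_l)
    fix t :: real assume t: "t > 0"
    \<comment> \<open>The factor \<open>t\<close> split off here is the one supplied by the
      substitution, which explains the exponent \<open>q - 1\<close> in the integrand.\<close>
    have tq: "complex_of_real (t powr q) = of_real t * of_real (t powr (q - 1))"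
      using t by (simp add: powr_diff)
    have "inverse (z + v t) * - of_real (t powr q) / (- of_real (t powr q) - m)
        - inverse (z + u t) * - of_real (t powr q) / (- of_real (t powr q) - m)
        = (inverse (z + v t) - inverse (z + u t)) * (of_real (t powr q) / (m + of_real (t powr q)))"
      unfolding kernel_side by (simp add: left_diff_distrib diff_divide_distrib)
    also have "\<dots> = 2 * \<i> * of_real q * (of_real (t / q) * ?\<phi> t)"
      unfolding resolvent_jump[OF t] tq using q by (simp add: mult_ac)
    finally show "F (Complex (q * ln t) (-pi)) * exp (Complex (q * ln t) (-pi)) / (exp (Complex (q * ln t) (-pi)) - exp l)
        - F (Complex (q * ln t) pi) * exp (Complex (q * ln t) pi) / (exp (Complex (q * ln t) pi) - exp l)
        = 2 * \<i> * of_real q * (of_real (t / q) * ?\<phi> t)"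
      by (simp only: F_side[OF t] exp_horizontal[OF t] exp_l)
  qed (use q in auto)
  moreover have "inverse (z + f \<mu>) = recip_add z L + of_real (q / pi) * ?I"
    unfolding F_l[symmetric] using q by (simp add: field_simps)
  ultimately show ?thesis
    unfolding u_def v_def m_def by blast
qed

text \<open>With the constant \<open>H = m\<close> the kernel \<open>m / (exp s - m)\<close> tends
  to 0 on the right and to -1 on the left. Now the left side carries the limit at 0, and the right
  side vanishes by boundedness alone.\<close>

lemma resolvent_formula_at_zero:
  assumes L: "has_limit_at_zero f L"
  shows "\<exists>I. has_improper_integral
            (\<lambda>t. of_real (Im (f (of_real t * cis (pi / q)))) * \<mu> powr of_real q /
                 ((z + f (of_real t * cis (pi / q))) * (z + f (of_real t * cis (- (pi / q)))) *
                  (\<mu> powr of_real q + of_real (t powr q)) * of_real t)) I \<and>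
          inverse (z + f \<mu>) = recip_add z L - of_real (q / pi) * I"
proof -
  have "((\<lambda>t. inverse (z + f (of_real t))) \<longlongrightarrow> recip_add z L) (at_right 0)"
    using L f_of_real_nonneg unfolding has_limit_at_zero_def
    by (intro inverse_add_tendsto_recip_add z Arg_z_less) (auto intro: eventually_mono[OF eventually_at_right_less[of 0]])
  moreover have "LIM x at_bot. exp (x / q) :> at_right 0"
  proof (rule filterlim_compose[where g = exp])
    show "LIM x at_bot. exp (x::real) :> at_right 0"
      by (rule tendsto_imp_filterlim_at_right[OF exp_at_bot]) simp
    show "LIM x at_bot. x / q :> at_bot"
      using filterlim_tendsto_pos_mult_at_bot[OF tendsto_const _ filterlim_ident, of "1 / q"] q by simp
  qed
  ultimately have lim: "((\<lambda>x. F (of_real x)) \<longlongrightarrow> recip_add z L) at_bot"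
    unfolding F_of_real by (rule filterlim_compose)
  let ?\<phi> = "\<lambda>t. of_real (Im (u t)) * m / ((z + u t) * (z + v t) * (m + of_real (t powr q)) * of_real t)"
  \<comment> \<open>The constant is now \<open>- 2 * \<i> * q\<close>: on the horizontal sides the
    denominator is negated but the numerator \<open>m\<close> is not, unlike the numerator
    \<open>exp s\<close> of the other kernel. This is the minus sign in the formula.\<close>
  let ?I = "(2 * pi * \<i> * F l - \<i> * (0 - 2 * pi * (recip_add z L * -1))) / (- 2 * \<i> * of_real q)"
  have "has_improper_integral ?\<phi> ?I"
  proof (rule has_improper_integral_strip[OF F_holomorphic holomorphic_on_const \<Theta>(1) \<Theta>_l exp_l[symmetric] q_pos])
    show "continuous_on {0<..} ?\<phi>"
      using denominator_nonzero m_plus_powr_nonzero by (intro continuous_intros continuous_on_ray) auto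
    show "((\<lambda>X. integral {-pi..pi} (\<lambda>y. F (Complex X y) * m / (exp (Complex X y) - exp l))) \<longlongrightarrow> 0) at_top"
      using side_integral_vanishes[where k = "\<lambda>s. m / (exp s - m)",
          OF F_holomorphic F_bound \<Theta>(1) uniform_limit_kernel_at_top(1)
            kernel_continuous_at_top[OF _ continuous_on_const]]
      by (simp add: exp_l)
    show "((\<lambda>X. integral {-pi..pi} (\<lambda>y. F (Complex X y) * m / (exp (Complex X y) - exp l)))
        \<longlongrightarrow> 2 * pi * (recip_add z L * -1)) at_bot"
      using side_integral_tendsto_at_bot[where k = "\<lambda>s. m / (exp s - m)",
          OF F_holomorphic F_bound \<Theta>(1) lim uniform_limit_kernel_at_bot(1)[OF m_nonzero]
            kernel_continuous_at_bot[OF _ continuous_on_const]]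
      by (simp add: exp_l)
    fix t :: real assume t: "t > 0"
    have "inverse (z + v t) * m / (- of_real (t powr q) - m) - inverse (z + u t) * m / (- of_real (t powr q) - m)
        = - (inverse (z + v t) - inverse (z + u t)) * (m / (m + of_real (t powr q)))"
      unfolding kernel_side by (simp add: left_diff_distrib diff_divide_distrib)
    \<comment> \<open>The factor \<open>1 / t\<close> of the integrand cancels the \<open>t\<close>
      from the substitution.\<close>
    also have "\<dots> = - 2 * \<i> * of_real q * (of_real (t / q) * ?\<phi> t)"
      unfolding resolvent_jump[OF t] using q t by (simp add: mult_ac)
    finally show "F (Complex (q * ln t) (-pi)) * m / (exp (Complex (q * ln t) (-pi)) - exp l)
        - F (Complex (q * ln t) pi) * m / (exp (Complex (q * ln t) pi) - exp l)
        = - 2 * \<i> * of_real q * (of_real (t / q) * ?\<phi> t)"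
      by (simp only: F_side[OF t] exp_horizontal[OF t] exp_l)
  qed (use q in auto)
  moreover have "inverse (z + f \<mu>) = recip_add z L - of_real (q / pi) * ?I"
    unfolding F_l[symmetric] using q by (simp add: field_simps)
  ultimately show ?thesis
    unfolding u_def v_def m_def by blast
qed

end

theorem lemma2p2:
  fixes f :: "complex \<Rightarrow> complex" and q :: real and \<mu> z :: complex
  assumes "f \<in> NP_plus"
    and "q > 2"
    and "\<mu> \<in> sector (pi / q)"
    and "z \<in> sector (pi - pi / q)"
  shows
    "(\<forall>L. has_limit_at_infinity f L \<longrightarrow>
       (\<exists>I. has_improper_integral
              (\<lambda>t. of_real (Im (f (of_real t * cis (pi / q)))) * of_real (t powr (q - 1)) /
                   ((z + f (of_real t * cis (pi / q))) * (z + f (of_real t * cis (- (pi / q)))) *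
                    (\<mu> powr of_real q + of_real (t powr q)))) I \<and>
            inverse (z + f \<mu>) = recip_add z L + of_real (q / pi) * I)) \<and>
     (\<forall>L. has_limit_at_zero f L \<longrightarrow>
       (\<exists>I. has_improper_integral
              (\<lambda>t. of_real (Im (f (of_real t * cis (pi / q)))) * \<mu> powr of_real q /
                   ((z + f (of_real t * cis (pi / q))) * (z + f (of_real t * cis (- (pi / q)))) *
                    (\<mu> powr of_real q + of_real (t powr q)) * of_real t)) I \<and>
            inverse (z + f \<mu>) = recip_add z L - of_real (q / pi) * I))"
proof -
  have q: "q > 2" using assms by simp
  have \<mu>: "\<mu> \<noteq> 0" "\<bar>Arg \<mu>\<bar> < pi / q" and z: "z \<noteq> 0" "\<bar>Arg z\<bar> < pi - pi / q"
    using assms by (auto simp: sector_def)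
  \<comment> \<open>The sector condition on \<open>\<mu>\<close> is exactly what puts the pole
    strictly between the two horizontal sides.\<close>
  have "\<bar>q * Arg \<mu>\<bar> < pi"
    using \<mu> q by (simp add: abs_mult field_simps)
  then obtain \<Theta> where \<Theta>: "pi < \<Theta>" "\<Theta> + \<bar>q * Arg \<mu>\<bar> \<le> 2 * pi" "\<Theta> \<le> q * (pi / 2)"
      "\<bar>Arg z\<bar> + \<Theta> / q < pi"
    using strip_width_exists[OF q z(2)] by metis
  interpret resolvent_formula f q \<mu> z \<Theta>
    by unfold_locales (use assms(1) q \<mu> z \<Theta> in auto)
  show ?thesis
    using resolvent_formula_at_infinity resolvent_formula_at_zero by blast
qed

end
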